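(* Let $2\le m\le n$ and let $A$ be an $m\times n$ array whose entries are independent uniform random real numbers in $[0,1)$. The expected effective entropy of 2-sided range maximum queries on $A$ (queries for the position of the maximum element of $A$ in $[1\cdots i]\times[1\cdots j]$, over all $1\le i\le m$, $1\le j\le n$) is $\Theta(\log^2 n\,\log m)$ bits.
   Context: All logarithms are to base 2 and $\log^2 n=(\log n)^2$. Positions are given as (row, column), with rows $1,\dots,m$ and columns $1,\dots,n$. For a query range $q$, the answer is $\mathrm{RMQ}(A,q)=\mathrm{argmax}_{(i,j)\in q}A[i,j]$. Two arrays are equivalent with respect to a set of queries if they give the same answers to all queries in the set. An encoding maps arrays of known dimensions to bit strings so that all queries in the set can be answered from the bit string alone, without access to the array. The expected effective entropy, for a random array, is the minimum over all uniquely decodable encodings of the expected number of bits used; up to an additive constant it is the Shannon entropy of the random equivalence class of the array. *)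

theory Defs
  imports "HOL-Probability.Probability"
begin

type_synonym position = "nat \<times> nat"
type_synonym array = "position \<Rightarrow> real"

definition positions :: "nat \<Rightarrow> nat \<Rightarrow> position set" where
  "positions m n = {1..m} \<times> {1..n}"

definition arrays :: "nat \<Rightarrow> nat \<Rightarrow> array set" where
  "arrays m n = positions m n \<rightarrow>\<^sub>E (UNIV :: real set)"

definition random_array :: "nat \<Rightarrow> nat \<Rightarrow> array measure" where
  "random_array m n = (\<Pi>\<^sub>M p\<in>positions m n. uniform_measure lborel {0..<1})"

text \<open>On ties, \<^const>\<open>arg_max_on\<close> picks one maximizer, depending only on the set of
  maximizers; ties have probability 0 in a random array.\<close>

definition RMQ :: "array \<Rightarrow> position set \<Rightarrow> position" where
  "RMQ A q = arg_max_on A q"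

definition two_sided_queries :: "nat \<Rightarrow> nat \<Rightarrow> position set set" where
  "two_sided_queries m n = {{1..i} \<times> {1..j} | i j. i \<in> {1..m} \<and> j \<in> {1..n}}"

definition uniquely_decodable :: "bool list set \<Rightarrow> bool" where
  "uniquely_decodable C \<longleftrightarrow>
     (\<forall>ws \<in> lists C. \<forall>ws' \<in> lists C. concat ws = concat ws' \<longrightarrow> ws = ws')"

text \<open>The decoder \<open>dec\<close> sees the bit string and the query only. Being chosen for fixed
  \<open>m\<close> and \<open>n\<close>, it also knows the dimensions.\<close>

definition is_encoding ::
    "nat \<Rightarrow> nat \<Rightarrow> position set set \<Rightarrow> (array \<Rightarrow> bool list) \<Rightarrow> bool" where
  "is_encoding m n Q enc \<longleftrightarrow>
     (\<exists>dec :: bool list \<Rightarrow> position set \<Rightarrow> position.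
        \<forall>A \<in> arrays m n. \<forall>q \<in> Q. dec (enc A) q = RMQ A q)"

text \<open>The encoding has to be a random variable for its expected length to make sense.\<close>

definition ud_encodings :: "nat \<Rightarrow> nat \<Rightarrow> position set set \<Rightarrow> (array \<Rightarrow> bool list) set" where
  "ud_encodings m n Q =
     {enc \<in> random_array m n \<rightarrow>\<^sub>M count_space UNIV.
        is_encoding m n Q enc \<and> uniquely_decodable (enc ` arrays m n)}"

definition expected_length :: "nat \<Rightarrow> nat \<Rightarrow> (array \<Rightarrow> bool list) \<Rightarrow> ennreal" where
  "expected_length m n enc = (\<integral>\<^sup>+ A. of_nat (length (enc A)) \<partial>random_array m n)"

definition expected_effective_entropy :: "nat \<Rightarrow> nat \<Rightarrow> position set set \<Rightarrow> ennreal" where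
  "expected_effective_entropy m n Q = (INF enc \<in> ud_encodings m n Q. expected_length m n enc)"

end

theory Submission
  imports Defs
begin

text \<open>Upper bound: call \<open>(i, j)\<close> a record if it holds the maximum of
  \<open>[1..i] \<times> [1..j]\<close>. Every answer is a record, so the records listed in increasing order of
  their values determine all answers: the answer is the last record in the query. A position takes
  \<open>O(log n)\<close> bits, and \<open>(i, j)\<close> is a record with probability \<open>1 / (i j)\<close>, so the
  expected number of records is the product of two harmonic numbers, which is
  \<open>O(log m log n)\<close>.

  Lower bound: for each pair \<open>(k, l)\<close> of scales, the maximum of
  \<open>[1..2^(k+1)] \<times> [1..2^(l+1)]\<close> lies in its last dyadic block
  \<open>(2^k, 2^(k+1)] \<times> (2^l, 2^(l+1)]\<close> with probability 1/4. Permuting the entries within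
  blocks does not change the distribution, so given that this happens the position is uniform on the
  block, independently for all scales. It contributes \<open>k + l\<close> bits, and the sum of
  \<open>(k + l) / 4\<close> over all scales has the order \<open>log^2 n log m\<close>.\<close>

section \<open>Strict maxima in arrays of independent entries\<close>

text \<open>The order relation that an array induces on \<open>P\<close>. For finite
  \<open>P\<close> it has finitely many values, and it determines all answers, ties included.
  Measurability of events about maxima thus reduces to single comparisons of entries.\<close>

definition pattern :: "position set \<Rightarrow> array \<Rightarrow> (position \<times> position) set" where
  "pattern P A = {(p, r) \<in> P \<times> P. A p \<le> A r}"

lemma pattern_le_iff:
  assumes "pattern P A = pattern P A'" "p \<in> P" "r \<in> P"
  shows "A p \<le> A r \<longleftrightarrow> A' p \<le> A' r"
proof -
  have "(p, r) \<in> pattern P A \<longleftrightarrow> (p, r) \<in> pattern P A'" using assms(1) by simp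
  then show ?thesis using assms(2,3) by (simp add: pattern_def)
qed

lemma pattern_subset: "pattern P A \<subseteq> P \<times> P"
  by (auto simp: pattern_def)

text \<open>Both arrays have the same maximizers on \<open>q\<close>, and the choice made by
  \<open>arg_max_on\<close> depends on the set of maximizers alone, so ties are covered as
  well.\<close>

lemma RMQ_cong:
  assumes "pattern P A = pattern P A'" "q \<subseteq> P"
  shows "RMQ A q = RMQ A' q"
proof -
  have "is_arg_max A (\<lambda>x. x \<in> q) = is_arg_max A' (\<lambda>x. x \<in> q)"
    unfolding is_arg_max_linorder fun_eq_iff using pattern_le_iff[OF assms(1)] assms(2) by blast
  then show ?thesis by (simp add: RMQ_def arg_max_on_def arg_max_def)
qed

lemma RMQ_is_max:
  assumes "finite q" "q \<noteq> {}"
  shows "RMQ A q \<in> q" "\<And>p. p \<in> q \<Longrightarrow> A p \<le> A (RMQ A q)"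
proof -
  have "Max (A ` q) \<in> A ` q" using assms by simp
  then obtain p where p: "p \<in> q" "A p = Max (A ` q)" by auto
  have "is_arg_max A (\<lambda>x. x \<in> q) p"
    using p assms by (auto simp: is_arg_max_linorder)
  then have "is_arg_max A (\<lambda>x. x \<in> q) (RMQ A q)"
    unfolding RMQ_def arg_max_on_def arg_max_def by (rule someI)
  then show "RMQ A q \<in> q" "\<And>p. p \<in> q \<Longrightarrow> A p \<le> A (RMQ A q)"
    by (auto simp: is_arg_max_linorder)
qed

definition strict_max :: "array \<Rightarrow> position set \<Rightarrow> position \<Rightarrow> bool" where
  "strict_max A q p \<longleftrightarrow> p \<in> q \<and> (\<forall>r \<in> q - {p}. A r < A p)"

lemma strict_max_unique: "strict_max A q p \<Longrightarrow> strict_max A q r \<Longrightarrow> p = r"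
  unfolding strict_max_def by (metis DiffI less_asym singletonD)

lemma strict_max_RMQ:
  assumes "inj_on A P" "q \<subseteq> P" "finite q" "q \<noteq> {}"
  shows "strict_max A q (RMQ A q)"
  unfolding strict_max_def
proof (intro conjI ballI)
  show "RMQ A q \<in> q" using RMQ_is_max assms by blast
  fix r assume r: "r \<in> q - {RMQ A q}"
  then have "A r \<noteq> A (RMQ A q)"
    using inj_onD[OF assms(1), of r "RMQ A q"] \<open>RMQ A q \<in> q\<close> assms(2) by auto
  then show "A r < A (RMQ A q)" using RMQ_is_max(2)[OF assms(3,4), of r A] r by force
qed

lemma strict_max_iff:
  assumes "inj_on A P" "q \<subseteq> P" "finite q" "q \<noteq> {}"
  shows "strict_max A q p \<longleftrightarrow> RMQ A q = p"
  using strict_max_RMQ[OF assms] strict_max_unique by blast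

section \<open>Independent entries without atoms: measurability and absence of ties\<close>

locale iid_array =
  fixes M :: "real measure" and P :: "position set"
  assumes prob_M: "prob_space M" and finite_P: "finite P"
    and sets_M [measurable_cong]: "sets M = sets borel"
    and no_atoms: "\<And>x. emeasure M {x} = 0"
begin

abbreviation N :: "array measure" where "N \<equiv> \<Pi>\<^sub>M p\<in>P. M"

sublocale N: prob_space N
  by (intro prob_space_PiM prob_M)

lemma space_N: "space N = P \<rightarrow>\<^sub>E UNIV"
  using sets_eq_imp_space_eq[OF sets_M] by (simp add: space_PiM)

lemma component_measurable: "p \<in> P \<Longrightarrow> (\<lambda>A. A p) \<in> borel_measurable N"
  using measurable_component_singleton[of p P "\<lambda>_. M"] measurable_cong_sets[OF refl sets_M] by blast

text \<open>Prescribing the pattern prescribes finitely many comparisons of two coordinates, each of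
  which is a measurable event.\<close>

lemma pattern_measurable: "pattern P \<in> N \<rightarrow>\<^sub>M count_space UNIV"
proof -
  have "pattern P \<in> N \<rightarrow>\<^sub>M count_space (Pow (P \<times> P))"
  proof (subst measurable_count_space_eq2, goal_cases)
    case 1 then show ?case using finite_P by simp
  next
    case 2
    have "pattern P -` {c} \<inter> space N \<in> sets N" if c: "c \<subseteq> P \<times> P" for c
    proof -
      define R where "R x A \<longleftrightarrow> (A (fst x) \<le> A (snd x) \<longleftrightarrow> x \<in> c)"
        for x :: "position \<times> position" and A :: array
      have "{A \<in> space N. R x A} \<in> sets N" if "x \<in> P \<times> P" for x
        using that component_measurable[of "fst x"] component_measurable[of "snd x"]
        unfolding R_def by (cases "x \<in> c") (auto simp: not_le)
      then have "{A \<in> space N. \<forall>x \<in> P \<times> P. R x A} \<in> sets N"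
        using finite_P by (intro sets.sets_Collect_finite_All) auto
      moreover have "pattern P A = c \<longleftrightarrow> (\<forall>x \<in> P \<times> P. R x A)" for A
      proof -
        have "pattern P A = c \<longleftrightarrow> (\<forall>x \<in> P \<times> P. x \<in> pattern P A \<longleftrightarrow> x \<in> c)"
          using c pattern_subset[of P A] by blast
        moreover have "x \<in> pattern P A \<longleftrightarrow> A (fst x) \<le> A (snd x)" if "x \<in> P \<times> P" for x
          using that by (cases x) (simp add: pattern_def)
        ultimately show ?thesis unfolding R_def by simp
      qed
      ultimately show ?thesis by (simp add: vimage_def Int_def conj_commute)
    qed
    then show ?case using pattern_subset by auto
  qed
  then show ?thesis
    by (rule measurable_compose) auto
qed

text \<open>Such an \<open>f\<close> factors through the pattern: \<open>g\<close> evaluates it at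
  one chosen array for each pattern.\<close>

lemma pattern_function_measurable:
  assumes "\<And>A A'. pattern P A = pattern P A' \<Longrightarrow> f A = f A'"
  shows "f \<in> N \<rightarrow>\<^sub>M count_space UNIV"
proof -
  define g where "g c = f (SOME A. pattern P A = c)" for c
  have "f A = g (pattern P A)" for A
    unfolding g_def by (rule assms) (metis (mono_tags, lifting) someI)
  then have "f = g \<circ> pattern P" by auto
  then show ?thesis using pattern_measurable by (simp add: measurable_comp[where N = "count_space UNIV"])
qed

lemma pattern_event:
  assumes "\<And>A A'. pattern P A = pattern P A' \<Longrightarrow> \<Phi> A \<longleftrightarrow> \<Phi> A'"
  shows "{A \<in> space N. \<Phi> A} \<in> sets N"
proof -
  have "\<Phi> \<in> N \<rightarrow>\<^sub>M count_space UNIV"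
    by (rule pattern_function_measurable) (erule assms)
  then have "\<Phi> -` {True} \<inter> space N \<in> sets N" by (rule measurable_sets) simp
  then show ?thesis by (simp add: vimage_def Int_def conj_commute)
qed

lemma strict_max_pattern:
  assumes "pattern P A = pattern P A'" "q \<subseteq> P"
  shows "strict_max A q p \<longleftrightarrow> strict_max A' q p"
proof (cases "p \<in> q")
  case True
  have "A r < A p \<longleftrightarrow> A' r < A' p" if "r \<in> q" for r
    using pattern_le_iff[OF assms(1), of p r] True that assms(2) by (auto simp: not_le[symmetric])
  then show ?thesis by (auto simp: strict_max_def)
qed (simp add: strict_max_def)

lemma inj_on_pattern:
  assumes "pattern P A = pattern P A'"
  shows "inj_on A P \<longleftrightarrow> inj_on A' P"
proof -
  have "A p = A r \<longleftrightarrow> A' p = A' r" if "p \<in> P" "r \<in> P" for p r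
    using pattern_le_iff[OF assms that] pattern_le_iff[OF assms that(2,1)] by (simp add: order_eq_iff)
  then show ?thesis unfolding inj_on_def by simp
qed

text \<open>Absence of atoms enters here. The coordinate \<open>p\<close> is split off as an
  independent factor; for each fixed value \<open>x\<close> of it, the coordinate \<open>r\<close>
  avoids the null set \<open>{x}\<close> almost surely, and integrating over \<open>x\<close>
  finishes.\<close>

lemma AE_neq:
  assumes "p \<in> P" "r \<in> P" "p \<noteq> r"
  shows "AE A in N. A p \<noteq> A r"
proof -
  let ?R = "\<Pi>\<^sub>M p\<in>P - {p}. M"
  interpret R: prob_space ?R by (intro prob_space_PiM prob_M)
  interpret M: prob_space M by (rule prob_M)
  interpret MR: pair_prob_space M ?R ..
  have r[measurable]: "(\<lambda>X. X r) \<in> ?R \<rightarrow>\<^sub>M M"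
    using assms by (intro measurable_component_singleton) auto
  have upd: "(\<lambda>(x, X). X(p := x)) \<in> M \<Otimes>\<^sub>M ?R \<rightarrow>\<^sub>M N"
    using measurable_compose[OF measurable_pair_swap' measurable_add_dim[of p "P - {p}" "\<lambda>_. M"]] assms(1)
    by (simp add: insert_absorb case_prod_beta)
  have "N = distr (M \<Otimes>\<^sub>M ?R) N (\<lambda>(x, X). X(p := x))"
    using distr_pair_PiM_eq_PiM[of "P - {p}" "\<lambda>_. M" p] prob_M assms(1) by (simp add: insert_absorb)
  moreover have "AE A in distr (M \<Otimes>\<^sub>M ?R) N (\<lambda>(x, X). X(p := x)). A p \<noteq> A r"
  proof (subst AE_distr_iff[OF upd])
    show "{A \<in> space N. A p \<noteq> A r} \<in> sets N"
      using pattern_le_iff assms(1,2) by (intro pattern_event) (metis order_antisym order_refl)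
    have "AE z in M \<Otimes>\<^sub>M ?R. fst z \<noteq> snd z r"
    proof (rule MR.AE_pair_measure)
      have "(\<lambda>z. snd z r) \<in> M \<Otimes>\<^sub>M ?R \<rightarrow>\<^sub>M M" by (rule measurable_compose[OF measurable_snd r])
      then have "(\<lambda>z. snd z r) \<in> borel_measurable (M \<Otimes>\<^sub>M ?R)"
        using measurable_cong_sets[OF refl sets_M] by blast
      moreover have "fst \<in> borel_measurable (M \<Otimes>\<^sub>M ?R)" by measurable
      ultimately show "{z \<in> space (M \<Otimes>\<^sub>M ?R). fst z \<noteq> snd z r} \<in> sets (M \<Otimes>\<^sub>M ?R)" by measurable
      have "AE z in M. x \<noteq> z" for x
        by (rule AE_I[where N = "{x}"]) (auto simp: no_atoms sets_M)
      then show "AE x in M. AE X in ?R. fst (x, X) \<noteq> snd (x, X) r"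
        using AE_PiM_component[of "P - {p}" "\<lambda>_. M" r] prob_M assms by auto
    qed
    then show "AE x in M \<Otimes>\<^sub>M ?R. (case x of (x, X) \<Rightarrow> X(p := x)) p \<noteq> (case x of (x, X) \<Rightarrow> X(p := x)) r"
      using assms(3) by (auto simp: case_prod_beta)
  qed
  ultimately show ?thesis
    by (rule ssubst[where P = "\<lambda>X. AE A in X. A p \<noteq> A r"])
qed

lemma AE_inj_on: "AE A in N. inj_on A P"
proof -
  have "AE A in N. \<forall>p \<in> P. \<forall>r \<in> P. p \<noteq> r \<longrightarrow> A p \<noteq> A r"
    using AE_neq finite_P by (intro AE_finite_allI) auto
  then show ?thesis by (rule AE_mp) (auto simp: inj_on_def)
qed

section \<open>Symmetry under permutations and the law of the position of the maximum\<close>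

lemma prob_permute:
  assumes \<pi>: "inj_on \<pi> P" "\<pi> \<in> P \<rightarrow> P"
    and \<Phi>: "{A \<in> space N. \<Phi> A} \<in> sets N"
  shows "N.prob {A \<in> space N. \<Phi> (\<lambda>p\<in>P. A (\<pi> p))} = N.prob {A \<in> space N. \<Phi> A}"
proof -
  let ?f = "\<lambda>A. \<lambda>p\<in>P. A (\<pi> p)"
  have f: "?f \<in> N \<rightarrow>\<^sub>M N"
    using \<pi>(2) by (intro measurable_restrict measurable_component_singleton) auto
  \<comment> \<open>Since the entries are independent with a common law, reindexing by an injection
    of \<open>P\<close> into itself preserves the product measure.\<close>
  have "N.prob {A \<in> space N. \<Phi> A} = measure (distr N N ?f) {A \<in> space N. \<Phi> A}"
    using distr_PiM_reindex[of P "\<lambda>_. M", OF prob_M \<pi>] by simp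
  also have "\<dots> = N.prob (?f -` {A \<in> space N. \<Phi> A} \<inter> space N)"
    by (rule measure_distr[OF f \<Phi>])
  also have "?f -` {A \<in> space N. \<Phi> A} \<inter> space N = {A \<in> space N. \<Phi> (?f A)}"
    using measurable_space[OF f] by auto
  finally show ?thesis by simp
qed

lemma strict_max_permute:
  assumes "q \<subseteq> P" "p \<in> q" "bij_betw \<pi> q q"
  shows "strict_max (\<lambda>p\<in>P. A (\<pi> p)) q p \<longleftrightarrow> strict_max A q (\<pi> p)"
proof -
  have "(\<lambda>p\<in>P. A (\<pi> p)) r = A (\<pi> r)" if "r \<in> q" for r
    using assms(1) that by auto
  then have "strict_max (\<lambda>p\<in>P. A (\<pi> p)) q p \<longleftrightarrow> (\<forall>r \<in> q - {p}. A (\<pi> r) < A (\<pi> p))"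
    using assms(2) by (simp add: strict_max_def)
  also have "\<dots> \<longleftrightarrow> (\<forall>r \<in> \<pi> ` (q - {p}). A r < A (\<pi> p))" by blast
  also have "\<pi> ` (q - {p}) = q - {\<pi> p}"
    using assms(2,3) by (auto simp: bij_betw_def inj_on_def)
  finally show ?thesis
    using assms(2,3) by (auto simp: strict_max_def bij_betw_def)
qed

text \<open>Transposing two cells of a block inside which all queries are constant does not change
  the distribution, so the position of the maximum is uniform on the block even given the
  maxima in the other blocks.\<close>

lemma prob_strict_max_le:
  assumes "finite I"
    and "\<And>b. b \<in> I \<Longrightarrow> Q b \<subseteq> P"
    and "\<And>b. b \<in> I \<Longrightarrow> B b \<subseteq> Q b"
    and "\<And>b b'. b \<in> I \<Longrightarrow> b' \<in> I \<Longrightarrow> b \<noteq> b' \<Longrightarrow> B b \<inter> B b' = {}"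
    and "\<And>b b'. b \<in> I \<Longrightarrow> b' \<in> I \<Longrightarrow> B b \<subseteq> Q b' \<or> B b \<inter> Q b' = {}"
    and "\<And>b. b \<in> I \<Longrightarrow> s b \<in> B b"
  shows "N.prob {A \<in> space N. \<forall>b \<in> I. strict_max A (Q b) (s b)} * (\<Prod>b\<in>I. real (card (B b))) \<le> 1"
  using assms
proof (induction I rule: finite_induct)
  case empty
  then show ?case by simp
next
  case (insert b I)
  let ?G = "{A \<in> space N. \<forall>b' \<in> I. strict_max A (Q b') (s b')}"
  \<comment> \<open>For \<open>y\<close> in the new block the events \<open>F y\<close> are
    disjoint, contained in \<open>?G\<close> and, by symmetry, equally likely. Each therefore has
    probability at most that of \<open>?G\<close> divided by \<open>card (B b)\<close>.\<close>
  define F where "F y = {A \<in> space N. strict_max A (Q b) y \<and> (\<forall>b' \<in> I. strict_max A (Q b') (s b'))}" for y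
  have Q: "b' \<in> insert b I \<Longrightarrow> Q b' \<subseteq> P" for b' using insert.prems(1) .
  have F_sets: "F y \<in> sets N" for y
    unfolding F_def using Q by (intro pattern_event) (metis strict_max_pattern insertI1 insertI2)
  have G_sets: "?G \<in> sets N"
    using Q by (intro pattern_event) (metis strict_max_pattern insertI2)
  have B_P: "B b \<subseteq> P" using insert.prems(2)[of b] Q[of b] by auto
  have sb: "s b \<in> B b" using insert.prems(5) by simp
  have F_eq: "N.prob (F y) = N.prob (F (s b))" if y: "y \<in> B b" for y
  proof -
    \<comment> \<open>The transposition of \<open>y\<close> and \<open>s b\<close>. Every query
      region contains the block \<open>B b\<close> or misses it, so it is mapped onto itself;
      \<open>s b'\<close> stays fixed for the other \<open>b'\<close> because their blocks are
      disjoint from \<open>B b\<close>.\<close>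
    define \<pi> where "\<pi> = (\<lambda>x. if x = y then s b else if x = s b then y else x)"
    have bij: "bij_betw \<pi> S S" if "B b \<subseteq> S \<or> B b \<inter> S = {}" for S
      using that y sb by (auto simp: \<pi>_def bij_betw_def inj_on_def image_iff)
    have \<pi>_P: "bij_betw \<pi> P P" using B_P by (rule bij[OF disjI1])
    have \<pi>_s: "\<pi> (s b) = y" by (simp add: \<pi>_def)
    have 1: "strict_max (\<lambda>p\<in>P. A (\<pi> p)) (Q b) (s b) \<longleftrightarrow> strict_max A (Q b) y" for A
      using strict_max_permute[of "Q b" "s b" \<pi> A, unfolded \<pi>_s] Q[of b] insert.prems(2)[of b]
        bij[of "Q b"] sb by blast
    have 2: "strict_max (\<lambda>p\<in>P. A (\<pi> p)) (Q b') (s b') \<longleftrightarrow> strict_max A (Q b') (s b')"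
      if b': "b' \<in> I" for b' A
    proof -
      have s: "s b' \<in> B b'" "B b \<inter> B b' = {}" "s b' \<in> Q b'"
        using insert.prems(2,3,5) insert.hyps b' by blast+
      then have "\<pi> (s b') = s b'" using y sb by (auto simp: \<pi>_def)
      then show ?thesis
        using strict_max_permute[of "Q b'" "s b'" \<pi> A] Q b' s(3) bij[OF insert.prems(4)[of b b']] by simp
    qed
    have "F y = {A \<in> space N. strict_max (\<lambda>p\<in>P. A (\<pi> p)) (Q b) (s b) \<and>
        (\<forall>b' \<in> I. strict_max (\<lambda>p\<in>P. A (\<pi> p)) (Q b') (s b'))}"
      unfolding F_def 1 using 2 by auto
    also have "N.prob \<dots> = N.prob (F (s b))"
      using prob_permute[OF _ _ F_sets[of "s b", unfolded F_def], of \<pi>] \<pi>_P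
      unfolding F_def bij_betw_def by blast
    finally show ?thesis .
  qed
  have fin_B: "finite (B b)" using B_P finite_P finite_subset by blast
  have "real (card (B b)) * N.prob (F (s b)) = (\<Sum>y\<in>B b. N.prob (F y))"
    using F_eq by simp
  also have "\<dots> = N.prob (\<Union>y\<in>B b. F y)"
    using fin_B F_sets
    by (intro N.finite_measure_finite_Union[symmetric])
       (auto simp: disjoint_family_on_def F_def dest: strict_max_unique)
  also have "\<dots> \<le> N.prob ?G"
    using G_sets by (intro N.finite_measure_mono) (auto simp: F_def)
  finally have "real (card (B b)) * N.prob (F (s b)) * (\<Prod>b\<in>I. real (card (B b)))
      \<le> N.prob ?G * (\<Prod>b\<in>I. real (card (B b)))"
    by (intro mult_right_mono prod_nonneg) auto
  also have "\<dots> \<le> 1" using insert.prems by (intro insert.IH) auto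
  finally show ?case
    using insert.hyps by (simp add: F_def ac_simps)
qed

text \<open>The case of a single block bounds the probability of each cell of \<open>q\<close> by
  \<open>1 / card q\<close>. Almost surely there is a strict maximum, so these probabilities add up
  to 1, which forces equality in every bound.\<close>

lemma prob_strict_max:
  assumes "q \<subseteq> P" "p \<in> q"
  shows "N.prob {A \<in> space N. strict_max A q p} = 1 / card q"
proof -
  have fin_q: "finite q" using assms(1) finite_P finite_subset by blast
  define f where "f r = N.prob {A \<in> space N. strict_max A q r}" for r
  have E: "{A \<in> space N. strict_max A q r} \<in> sets N" for r
    using assms(1) by (intro pattern_event) (metis strict_max_pattern)
  have le: "f r * card q \<le> 1" if "r \<in> q" for r
    using prob_strict_max_le[of "{()}" "\<lambda>_. q" "\<lambda>_. q" "\<lambda>_. r"] that assms(1) by (simp add: f_def)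
  have "1 = N.prob (\<Union>r\<in>q. {A \<in> space N. strict_max A q r})"
  proof (rule N.prob_eq_1[THEN iffD2, symmetric])
    show "AE A in N. A \<in> (\<Union>r\<in>q. {A \<in> space N. strict_max A q r})"
      using AE_inj_on AE_space
    proof eventually_elim
      case (elim A)
      then show ?case using strict_max_RMQ[OF elim(1) assms(1) fin_q] RMQ_is_max(1)[OF fin_q] assms(2)
        by blast
    qed
  qed (use E fin_q in auto)
  also have "\<dots> = (\<Sum>r\<in>q. f r)"
    unfolding f_def using fin_q E
    by (intro N.finite_measure_finite_Union) (auto simp: disjoint_family_on_def dest: strict_max_unique)
  finally have sum: "(\<Sum>r\<in>q. f r) = 1" by simp
  have card: "card q > 0" using fin_q assms(2) card_gt_0_iff by blast
  have f_le: "f r \<le> 1 / card q" if "r \<in> q" for r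
    using le[OF that] card by (simp add: field_simps)
  have "(\<Sum>r\<in>q. 1 / card q - f r) = 0"
    using sum card by (simp add: sum_subtractf)
  then have "1 / card q - f p = 0"
    using sum_nonneg_0[OF fin_q _ _ assms(2), of "\<lambda>r. 1 / card q - f r"] f_le by simp
  then show ?thesis by (simp add: f_def)
qed

lemma prob_RMQ:
  assumes "q \<subseteq> P" "p \<in> q"
  shows "N.prob {A \<in> space N. RMQ A q = p} = 1 / card q"
proof -
  have fin_q: "finite q" using assms(1) finite_P finite_subset by blast
  have "N.prob {A \<in> space N. RMQ A q = p} = N.prob {A \<in> space N. strict_max A q p}"
  proof (rule N.finite_measure_eq_AE)
    show "AE A in N. A \<in> {A \<in> space N. RMQ A q = p} \<longleftrightarrow> A \<in> {A \<in> space N. strict_max A q p}"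
      using AE_inj_on
    proof eventually_elim
      case (elim A)
      have "strict_max A q p \<longleftrightarrow> RMQ A q = p"
        using strict_max_iff[OF elim assms(1) fin_q] assms(2) by blast
      then show ?case by simp
    qed
    show "{A \<in> space N. RMQ A q = p} \<in> sets N"
      using assms(1) by (intro pattern_event) (metis RMQ_cong)
    show "{A \<in> space N. strict_max A q p} \<in> sets N"
      using assms(1) by (intro pattern_event) (metis strict_max_pattern)
  qed
  then show ?thesis using prob_strict_max[OF assms] by simp
qed

end

section \<open>Encoding by records\<close>

text \<open>The number of entries is not known to the decoder: a bit \<open>True\<close> announces
  another entry, and \<open>False\<close> ends the list.\<close>

definition list_code :: "('a \<Rightarrow> bool list) \<Rightarrow> 'a list \<Rightarrow> bool list" where
  "list_code f xs = concat (map (\<lambda>x. True # f x) xs) @ [False]"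

lemma length_list_code:
  "(\<And>x. x \<in> set xs \<Longrightarrow> length (f x) = L) \<Longrightarrow> length (list_code f xs) = length xs * (L + 1) + 1"
  by (induction xs) (auto simp: list_code_def)

text \<open>The arbitrary continuations \<open>u\<close> and \<open>v\<close> give injectivity and
  prefix-freeness in one statement. The leading bits show whether both lists continue, and the
  common length \<open>L\<close> allows the first entries to be cut off.\<close>

lemma list_code_append_inj:
  assumes "inj_on f S" "\<And>x. x \<in> S \<Longrightarrow> length (f x) = L"
    and "set xs \<subseteq> S" "set ys \<subseteq> S" "list_code f xs @ u = list_code f ys @ v"
  shows "xs = ys \<and> u = v"
  using assms(3-5)
proof (induction xs arbitrary: ys)
  case Nil
  then show ?case by (cases ys) (auto simp: list_code_def)
next
  case (Cons x xs)
  then obtain y ys' where ys: "ys = y # ys'" by (cases ys) (auto simp: list_code_def)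
  have "f x @ list_code f xs @ u = f y @ list_code f ys' @ v"
    using Cons.prems(3) by (simp add: list_code_def ys)
  moreover have "length (f x) = length (f y)" using Cons.prems ys assms(2) by simp
  ultimately have "f x = f y" "list_code f xs @ u = list_code f ys' @ v" by simp_all
  moreover have "x = y" using \<open>f x = f y\<close> Cons.prems ys assms(1) by (auto dest: inj_onD)
  ultimately show ?case using Cons.IH[of ys'] Cons.prems ys by simp
qed

text \<open>The first words of two equal concatenations agree and can be cancelled. The empty word
  is excluded because \<open>{[]}\<close> satisfies the second assumption, although
  \<open>[]\<close> and \<open>[[]]\<close> have the same concatenation.\<close>

lemma prefix_free_uniquely_decodable:
  assumes "[] \<notin> C" "\<And>w w' u u'. w \<in> C \<Longrightarrow> w' \<in> C \<Longrightarrow> w @ u = w' @ u' \<Longrightarrow> w = w'"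
  shows "uniquely_decodable C"
proof -
  have "ws = ws'" if "ws \<in> lists C" "ws' \<in> lists C" "concat ws = concat ws'" for ws ws'
    using that
  proof (induction ws arbitrary: ws' rule: list.induct)
    case Nil
    then show ?case using assms(1) by (cases ws') auto
  next
    case (Cons w ws)
    then obtain v vs where ws': "ws' = v # vs" using assms(1) by (cases ws') auto
    have "w \<in> C" "v \<in> C" "w @ concat ws = v @ concat vs" using Cons.prems ws' by auto
    from assms(2)[OF this] have "w = v" .
    then show ?case using Cons ws' by auto
  qed
  then show ?thesis unfolding uniquely_decodable_def by blast
qed

lemma fixed_length_code:
  assumes "finite S" "card S \<le> 2 ^ L"
  obtains f :: "'a \<Rightarrow> bool list" where "inj_on f S" "\<And>x. x \<in> S \<Longrightarrow> length (f x) = L"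
proof -
  let ?W = "{xs :: bool list. set xs \<subseteq> UNIV \<and> length xs = L}"
  have "card ?W = 2 ^ L" using card_lists_length_eq[of "UNIV :: bool set" L] by simp
  moreover have "finite ?W" by (rule finite_lists_length_eq) simp
  ultimately obtain f where "f ` S \<subseteq> ?W" "inj_on f S"
    using card_le_inj[of S ?W] assms by auto
  then show thesis using that by blast
qed

text \<open>A decoder may answer from any array with the given code word, so it suffices that equal
  words imply equal answers.\<close>

lemma is_encodingI:
  assumes "\<And>A A' q. A \<in> arrays m n \<Longrightarrow> A' \<in> arrays m n \<Longrightarrow> enc A = enc A' \<Longrightarrow> q \<in> Q \<Longrightarrow> RMQ A q = RMQ A' q"
  shows "is_encoding m n Q enc"
proof -
  define dec where "dec w q = RMQ (SOME A. A \<in> arrays m n \<and> enc A = w) q" for w q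
  have "dec (enc A) q = RMQ A q" if "A \<in> arrays m n" "q \<in> Q" for A q
  proof -
    have "\<exists>A'. A' \<in> arrays m n \<and> enc A' = enc A" using that by blast
    then have "(SOME A'. A' \<in> arrays m n \<and> enc A' = enc A) \<in> arrays m n \<and>
        enc (SOME A'. A' \<in> arrays m n \<and> enc A' = enc A) = enc A" by (rule someI_ex)
    then show ?thesis unfolding dec_def using assms that by blast
  qed
  then show ?thesis unfolding is_encoding_def by blast
qed

section \<open>Records and the code that lists them\<close>

definition dominated :: "position \<Rightarrow> position set" where
  "dominated p = {1..fst p} \<times> {1..snd p}"

definition is_record :: "array \<Rightarrow> position \<Rightarrow> bool" where
  "is_record A p \<longleftrightarrow> strict_max A (dominated p) p"

text \<open>Indexes the queries by their corner, so that answers and records are both attached to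
  positions.\<close>

lemma two_sided_queries_eq: "two_sided_queries m n = dominated ` positions m n"
  unfolding two_sided_queries_def dominated_def positions_def by force

lemma dominated_subset: "p \<in> positions m n \<Longrightarrow> dominated p \<subseteq> positions m n"
  by (auto simp: dominated_def positions_def)

lemma dominated_self: "p \<in> positions m n \<Longrightarrow> p \<in> dominated p"
  by (auto simp: dominated_def positions_def)

lemma finite_dominated [simp]: "finite (dominated p)"
  by (simp add: dominated_def)

lemma card_dominated: "card (dominated p) = fst p * snd p"
  by (simp add: dominated_def)

lemma dominated_mono: "r \<in> dominated p \<Longrightarrow> dominated r \<subseteq> dominated p"
  by (auto simp: dominated_def)

lemma finite_positions [simp]: "finite (positions m n)"
  by (simp add: positions_def)

text \<open>The order of the list conveys how the values at the records compare, without
  transmitting any value.\<close>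

definition sorted_records :: "position list \<Rightarrow> array \<Rightarrow> position list" where
  "sorted_records ps A = sort_key A (filter (is_record A) ps)"

text \<open>The answer \<open>r\<close> is itself a record, because the region dominated by
  \<open>r\<close> lies inside the query. It holds the largest value there, so no record inside the
  query can come after it in the sorted list.\<close>

lemma RMQ_eq_last_record:
  assumes A: "inj_on A (positions m n)" and ps: "set ps = positions m n" and p: "p \<in> positions m n"
  shows "RMQ A (dominated p) = last (filter (\<lambda>r. r \<in> dominated p) (sorted_records ps A))"
proof -
  define ys where "ys = filter (\<lambda>r. r \<in> dominated p) (sorted_records ps A)"
  define r where "r = RMQ A (dominated p)"
  have sub: "dominated p \<subseteq> positions m n" and ne: "dominated p \<noteq> {}"
    using dominated_subset[OF p] dominated_self[OF p] by auto
  have r: "strict_max A (dominated p) r"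
    unfolding r_def using strict_max_RMQ[OF A sub _ ne] by simp
  then have rp: "r \<in> dominated p" by (simp add: strict_max_def)
  then have "is_record A r"
    using r dominated_mono[OF rp] dominated_self[of r m n] sub
    by (auto simp: is_record_def strict_max_def)
  then have r_ys: "r \<in> set ys" using rp sub ps by (auto simp: ys_def sorted_records_def)
  have sorted: "sorted (map A ys)" unfolding ys_def sorted_records_def by (simp add: sorted_filter)
  have ne: "ys \<noteq> []" using r_ys by auto
  then have last: "last ys \<in> dominated p" using last_in_set[OF ne] by (simp add: ys_def)
  obtain i where i: "i < length ys" "ys ! i = r" using r_ys by (auto simp: in_set_conv_nth)
  have "A r \<le> A (last ys)"
    using sorted_nth_mono[OF sorted, of i "length ys - 1"] i by (simp add: last_conv_nth ne)
  then have "last ys = r" using r last unfolding strict_max_def by (meson Diff_iff leD singletonD)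
  then show ?thesis unfolding ys_def r_def by simp
qed

text \<open>Arrays with ties have to be encoded as well, at any cost: the first bit separates them from
  the others, and their answers are listed one by one.\<close>

definition record_code :: "(position \<Rightarrow> bool list) \<Rightarrow> position list \<Rightarrow> array \<Rightarrow> bool list" where
  "record_code f ps A =
     (if inj_on A (set ps) then False # list_code f (sorted_records ps A)
      else True # list_code f (map (\<lambda>p. RMQ A (dominated p)) ps))"

lemma RMQ_dominated_in_positions:
  "p \<in> positions m n \<Longrightarrow> RMQ A (dominated p) \<in> positions m n"
  using RMQ_is_max(1)[of "dominated p" A] dominated_self[of p m n] dominated_subset[of p m n] by auto

text \<open>The flag bit shows which of the two formats is present, and the list code then recovers
  the list. The first conclusion yields unique decodability; the second, taken with empty
  continuations, yields the decoder.\<close>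

lemma record_code_prefix_free:
  assumes ps: "set ps = positions m n" and f: "inj_on f (positions m n)" "\<And>x. x \<in> positions m n \<Longrightarrow> length (f x) = L"
    and eq: "record_code f ps A @ u = record_code f ps A' @ v"
  shows "record_code f ps A = record_code f ps A'"
    and "p \<in> positions m n \<Longrightarrow> RMQ A (dominated p) = RMQ A' (dominated p)"
proof -
  have set1: "set (sorted_records ps A) \<subseteq> positions m n" for A
    using ps by (auto simp: sorted_records_def)
  have set2: "set (map (\<lambda>p. RMQ A (dominated p)) ps) \<subseteq> positions m n" for A
    using ps RMQ_dominated_in_positions by auto
  have flag: "inj_on A (set ps) \<longleftrightarrow> inj_on A' (set ps)"
    using eq by (auto simp: record_code_def split: if_splits)
  have "record_code f ps A = record_code f ps A' \<and>
      (p \<in> positions m n \<longrightarrow> RMQ A (dominated p) = RMQ A' (dominated p))" for p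
  proof (cases "inj_on A (set ps)")
    case True
    then have eqs: "sorted_records ps A = sorted_records ps A'"
      using list_code_append_inj[OF f set1 set1] eq flag by (simp add: record_code_def)
    have "record_code f ps A = record_code f ps A'"
      unfolding record_code_def eqs using True flag by simp
    moreover have "RMQ A (dominated p) = RMQ A' (dominated p)" if "p \<in> positions m n" for p
      using RMQ_eq_last_record[OF _ ps that, of A] RMQ_eq_last_record[OF _ ps that, of A'] True flag
      unfolding eqs ps by simp
    ultimately show ?thesis by blast
  next
    case False
    have eqm: "map (\<lambda>p. RMQ A (dominated p)) ps = map (\<lambda>p. RMQ A' (dominated p)) ps"
    proof -
      have "list_code f (map (\<lambda>p. RMQ A (dominated p)) ps) @ u =
          list_code f (map (\<lambda>p. RMQ A' (dominated p)) ps) @ v"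
        using eq flag False by (simp add: record_code_def)
      from list_code_append_inj[OF f set2 set2 this] show ?thesis by (rule conjunct1)
    qed
    have "record_code f ps A = record_code f ps A'"
      unfolding record_code_def eqm using False flag by simp
    moreover have "RMQ A (dominated p) = RMQ A' (dominated p)" if "p \<in> positions m n" for p
      using eqm that ps by simp
    ultimately show ?thesis by blast
  qed
  then show "record_code f ps A = record_code f ps A'"
    and "p \<in> positions m n \<Longrightarrow> RMQ A (dominated p) = RMQ A' (dominated p)" by blast+
qed

text \<open>Each record costs its \<open>L\<close> address bits and one continuation bit; the 2
  extra bits are the flag and the end marker.\<close>

lemma length_record_code:
  assumes "inj_on A (set ps)" "distinct ps" "\<And>x. x \<in> set ps \<Longrightarrow> length (f x) = L"
  shows "length (record_code f ps A) = card {p \<in> set ps. is_record A p} * (L + 1) + 2"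
proof -
  have "length (filter (is_record A) ps) = card {p \<in> set ps. is_record A p}"
    using assms(2) distinct_card[of "filter (is_record A) ps"] by simp
  then show ?thesis
    using assms length_list_code[of "sorted_records ps A" f L]
    by (simp add: record_code_def sorted_records_def)
qed

section \<open>Upper bound: expected length of the record code\<close>

lemma iid_array_uniform: "iid_array (uniform_measure lborel {0..<1}) (positions m n)"
proof (rule iid_array.intro)
  show "prob_space (uniform_measure lborel {0..<1 :: real})"
    by (intro prob_space_uniform_measure) auto
  have "emeasure lborel ({0..<1} \<inter> {x}) = 0" for x :: real
    by (cases "x \<in> {0..<1}") auto
  then show "emeasure (uniform_measure lborel {0..<1}) {x} = 0" for x :: real
    by simp
qed auto

lemma space_random_array: "space (random_array m n) = arrays m n"
  using iid_array.space_N[OF iid_array_uniform] by (simp add: random_array_def arrays_def)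

text \<open>The harmonic number minus the logarithm is decreasing, hence the sum is at most
  \<open>1 + ln n\<close>. Both summands are at most \<open>log 2 n\<close>, as
  \<open>2 \<le> n\<close> and \<open>ln 2 < 1\<close>.\<close>

lemma sum_inverse_le_log2:
  assumes "2 \<le> n"
  shows "(\<Sum>i=1..n. 1 / real i) \<le> 2 * log 2 n"
proof -
  have "harm n - ln (real n) \<le> harm 1 - ln (real 1)"
    using euler_mascheroni_sequence_decreasing[of 1 n] assms by simp
  then have "(\<Sum>i=1..n. 1 / real i) \<le> 1 + ln n"
    by (simp add: harm_def inverse_eq_divide)
  moreover have "1 \<le> log 2 n" using assms by simp
  moreover have "ln (real n) \<le> log 2 n"
  proof -
    have "ln (real n) * ln 2 \<le> ln (real n) * 1"
      using ln_2_less_1 assms by (intro mult_left_mono) auto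
    then show ?thesis by (simp add: log_def field_simps)
  qed
  ultimately show ?thesis by linarith
qed

lemma expected_effective_entropy_le:
  assumes "1 \<le> m" "1 \<le> n" "m * n \<le> 2 ^ L"
  shows "expected_effective_entropy m n (two_sided_queries m n)
    \<le> ennreal ((\<Sum>i=1..m. 1 / real i) * (\<Sum>j=1..n. 1 / real j) * (L + 1) + 2)"
proof -
  let ?P = "positions m n"
  interpret iid_array "uniform_measure lborel {0..<1}" ?P by (rule iid_array_uniform)
  have N: "N = random_array m n" by (simp add: random_array_def)
  obtain ps where ps: "set ps = ?P" "distinct ps"
    using finite_distinct_list[OF finite_positions[of m n]] by blast
  have card: "card ?P \<le> 2 ^ L" using assms(3) by (simp add: positions_def)
  obtain c :: "position \<Rightarrow> bool list" where
    c: "inj_on c ?P" "\<And>x. x \<in> ?P \<Longrightarrow> length (c x) = L"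
    by (rule fixed_length_code[OF finite_positions card]) blast
  \<comment> \<open>Encoding a chosen representative of the order pattern makes the code word a
    function of the pattern, hence measurable. Answers and records do not change.\<close>
  define rep where "rep A = (SOME A'. pattern ?P A' = pattern ?P A)" for A
  have rep: "pattern ?P (rep A) = pattern ?P A" for A
    unfolding rep_def by (rule someI[of _ A]) simp
  define enc where "enc A = record_code c ps (rep A)" for A
  have RMQ_rep: "RMQ (rep A) (dominated p) = RMQ A (dominated p)" if "p \<in> ?P" for A p
    using RMQ_cong[OF rep dominated_subset[OF that]] .
  have rec: "is_record (rep A) p \<longleftrightarrow> is_record A p" if "p \<in> ?P" for A p
    unfolding is_record_def using strict_max_pattern[OF rep dominated_subset[OF that]] .
  have enc: "enc \<in> ud_encodings m n (two_sided_queries m n)"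
    unfolding ud_encodings_def
  proof (intro CollectI conjI)
    show "enc \<in> random_array m n \<rightarrow>\<^sub>M count_space UNIV"
      unfolding N[symmetric] by (rule pattern_function_measurable) (simp add: enc_def rep_def)
    show "is_encoding m n (two_sided_queries m n) enc"
    proof (rule is_encodingI)
      fix A A' q assume "enc A = enc A'" "q \<in> two_sided_queries m n"
      then show "RMQ A q = RMQ A' q"
        using record_code_prefix_free(2)[OF ps(1) c, of "rep A" "[]" "rep A'" "[]"] RMQ_rep
        by (auto simp: two_sided_queries_eq enc_def)
    qed
    show "uniquely_decodable (enc ` arrays m n)"
    proof (rule prefix_free_uniquely_decodable)
      show "[] \<notin> enc ` arrays m n" by (auto simp: enc_def record_code_def)
      show "w = w'" if "w \<in> enc ` arrays m n" "w' \<in> enc ` arrays m n" "w @ u = w' @ u'" for w w' u u'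
        using that record_code_prefix_free(1)[OF ps(1) c] unfolding enc_def by blast
    qed
  qed
  \<comment> \<open>The number of records as a sum of indicators, so that linearity of expectation
    applies without regard to dependence between records.\<close>
  define f where "f A = (\<Sum>p\<in>?P. indicat_real {A \<in> space N. is_record A p} A)" for A
  have E: "{A \<in> space N. is_record A p} \<in> sets N" if "p \<in> ?P" for p
    unfolding is_record_def using strict_max_pattern dominated_subset[OF that]
    by (intro pattern_event) blast
  have E_integrable: "integrable N (indicat_real {A \<in> space N. is_record A p})" if "p \<in> ?P" for p
    using E[OF that] by (intro integrable_real_indicator) (auto simp: N.emeasure_eq_measure)
  then have f_integrable: "integrable N f"
    unfolding f_def by (intro Bochner_Integration.integrable_sum)
  from enc have "expected_effective_entropy m n (two_sided_queries m n) \<le> expected_length m n enc"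
    unfolding expected_effective_entropy_def by (rule INF_lower)
  also have "expected_length m n enc = (\<integral>\<^sup>+ A. ennreal (f A * (L + 1) + 2) \<partial>N)"
    unfolding expected_length_def N[symmetric]
  proof (rule nn_integral_cong_AE)
    show "AE A in N. of_nat (length (enc A)) = ennreal (f A * (L + 1) + 2)"
      using AE_inj_on AE_space
    proof eventually_elim
      case (elim A)
      have "length (enc A) = card {p \<in> ?P. is_record A p} * (L + 1) + 2"
        unfolding enc_def
        using length_record_code[of "rep A" ps c L] ps c elim(1) inj_on_pattern[OF rep] rec
        by (simp cong: conj_cong)
      moreover have "real (card {p \<in> ?P. is_record A p}) = f A"
        using elim(2) by (simp add: f_def indicator_def sum.If_cases Int_def)
      ultimately have "real (length (enc A)) = f A * (L + 1) + 2" by (simp add: algebra_simps)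
      then show ?case by (simp only: ennreal_of_nat_eq_real_of_nat)
    qed
  qed
  also have "\<dots> = ennreal (\<integral>A. (f A * (L + 1) + 2) \<partial>N)"
  proof (rule nn_integral_eq_integral)
    show "integrable N (\<lambda>A. f A * real (L + 1) + 2)"
      using f_integrable by (intro Bochner_Integration.integrable_add integrable_mult_left) auto
    have "0 \<le> f A" for A by (auto simp: f_def intro: sum_nonneg)
    then show "AE A in N. 0 \<le> f A * real (L + 1) + 2" by simp
  qed
  also have "(\<integral>A. (f A * (L + 1) + 2) \<partial>N) = (\<integral>A. f A \<partial>N) * (L + 1) + 2"
    using f_integrable by (simp add: N.prob_space del: of_nat_Suc of_nat_add)
  also have "(\<integral>A. f A \<partial>N) = (\<Sum>p\<in>?P. N.prob {A \<in> space N. is_record A p})"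
    unfolding f_def using E_integrable
    by (subst Bochner_Integration.integral_sum) (auto simp: Int_absorb2 intro!: sum.cong)
  also have "(\<Sum>p\<in>?P. N.prob {A \<in> space N. is_record A p}) = (\<Sum>p\<in>?P. 1 / (real (fst p) * real (snd p)))"
  proof (rule sum.cong[OF refl])
    fix p assume "p \<in> ?P"
    then show "N.prob {A \<in> space N. is_record A p} = 1 / (real (fst p) * real (snd p))"
      unfolding is_record_def
      using prob_strict_max[OF dominated_subset dominated_self] by (simp add: card_dominated)
  qed
  also have "\<dots> = (\<Sum>i=1..m. 1 / real i) * (\<Sum>j=1..n. 1 / real j)"
    by (simp add: positions_def sum_product sum.cartesian_product case_prod_beta)
  finally show ?thesis .
qed

lemma expected_effective_entropy_upper:
  assumes "2 \<le> m" "m \<le> n"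
  shows "expected_effective_entropy m n (two_sided_queries m n)
    \<le> ennreal (18 * ((log 2 n)\<^sup>2 * log 2 m))"
proof -
  define x y where "x = log 2 m" and "y = log 2 n"
  have x: "1 \<le> x" and y: "1 \<le> y" "x \<le> y" using assms by (auto simp: x_def y_def)
  \<comment> \<open>Enough bits to address each of the \<open>m * n\<close> positions.\<close>
  define L where "L = nat \<lceil>x + y\<rceil>"
  have L: "x + y \<le> L" "L \<le> x + y + 1" using x y unfolding L_def by linarith+
  have "real (m * n) = 2 powr (x + y)" using assms by (simp add: x_def y_def powr_add)
  also have "\<dots> \<le> 2 powr L" using L by simp
  also have "\<dots> = real (2 ^ L)" by (simp add: powr_realpow)
  finally have "m * n \<le> 2 ^ L" by (simp only: of_nat_le_iff)
  then have "expected_effective_entropy m n (two_sided_queries m n)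
    \<le> ennreal ((\<Sum>i=1..m. 1 / real i) * (\<Sum>j=1..n. 1 / real j) * (L + 1) + 2)"
    using assms by (intro expected_effective_entropy_le) auto
  also have "\<dots> \<le> ennreal (18 * (y\<^sup>2 * x))"
  proof (rule ennreal_leI)
    \<comment> \<open>Here \<open>L + 1 \<le> x + y + 2 \<le> 4 * y\<close>. The product contributes
      16 to the constant 18, and the additive 2 is at most twice
      \<open>y\<^sup>2 * x\<close>.\<close>
    have "(\<Sum>i=1..m. 1 / real i) * (\<Sum>j=1..n. 1 / real j) * (L + 1) \<le> (2 * x) * (2 * y) * (4 * y)"
      using sum_inverse_le_log2[of m] sum_inverse_le_log2[of n] assms x y L unfolding x_def[symmetric] y_def[symmetric]
      by (intro mult_mono mult_nonneg_nonneg sum_nonneg) auto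
    moreover have "1 \<le> y\<^sup>2 * x" using mult_mono[of 1 "y\<^sup>2" 1 x] x y by simp
    ultimately show "(\<Sum>i=1..m. 1 / real i) * (\<Sum>j=1..n. 1 / real j) * real (L + 1) + 2 \<le> 18 * (y\<^sup>2 * x)"
      unfolding power2_eq_square by argo
  qed
  finally show ?thesis by (simp add: x_def y_def)
qed

section \<open>Counting words against block entropy\<close>

text \<open>The \<open>2 ^ l\<close> words of length \<open>l\<close> have total weight
  \<open>(1/2) ^ l\<close>, and the geometric series is bounded by 2.\<close>

lemma sum_words_le:
  assumes "finite F"
  shows "(\<Sum>w\<in>F. (1/4 :: real) ^ length (w :: bool list)) \<le> 2"
proof -
  define n where "n = Max (insert 0 (length ` F))"
  have n: "length w \<le> n" if "w \<in> F" for w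
    unfolding n_def using assms that by (intro Max_ge) auto
  let ?W = "\<lambda>l. {w :: bool list. set w \<subseteq> UNIV \<and> length w = l}"
  have fin: "finite (?W l)" for l by (rule finite_lists_length_eq) simp
  have card: "card (?W l) = 2 ^ l" for l
    using card_lists_length_eq[of "UNIV :: bool set" l] by simp
  have "(\<Sum>w\<in>F. (1/4 :: real) ^ length w) \<le> (\<Sum>w\<in>(\<Union>l\<le>n. ?W l). (1/4) ^ length w)"
    using n fin by (intro sum_mono2) auto
  also have "\<dots> = (\<Sum>l\<le>n. \<Sum>w\<in>?W l. (1/4) ^ length w)"
    using fin by (intro sum.UNION_disjoint) auto
  also have "\<dots> = (\<Sum>l\<le>n. (1/2) ^ l)"
  proof (rule sum.cong[OF refl])
    fix l
    have "(\<Sum>w\<in>?W l. (1/4 :: real) ^ length w) = (\<Sum>w\<in>?W l. (1/4) ^ l)" by (rule sum.cong) auto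
    also have "\<dots> = 2 ^ l * (1/4) ^ l" using card by simp
    also have "\<dots> = (1/2) ^ l" by (simp add: power_mult_distrib[symmetric])
    finally show "(\<Sum>w\<in>?W l. (1/4 :: real) ^ length w) = (1/2) ^ l" .
  qed
  also have "\<dots> \<le> 2" by (simp add: sum_gp0)
  finally show ?thesis .
qed

context iid_array
begin

text \<open>Only injectivity of the words on the answers is used: weighting a word \<open>w\<close> by
  \<open>4 ^ - length w\<close> makes the sum over all words finite, which avoids the Kraft-McMillan
  inequality at the price of a factor 2.\<close>

lemma expected_length_ge_block_entropy:
  fixes enc :: "array \<Rightarrow> bool list"
  assumes enc: "enc \<in> N \<rightarrow>\<^sub>M count_space UNIV"
    and dec: "\<And>A b. A \<in> space N \<Longrightarrow> b \<in> I \<Longrightarrow> dec (enc A) (Q b) = RMQ A (Q b)"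
    and I: "finite I"
    and Q: "\<And>b. b \<in> I \<Longrightarrow> Q b \<subseteq> P"
    and B: "\<And>b. b \<in> I \<Longrightarrow> B b \<subseteq> Q b" "\<And>b. b \<in> I \<Longrightarrow> B b \<noteq> {}"
    and disj: "\<And>b b'. b \<in> I \<Longrightarrow> b' \<in> I \<Longrightarrow> b \<noteq> b' \<Longrightarrow> B b \<inter> B b' = {}"
      "\<And>b b'. b \<in> I \<Longrightarrow> b' \<in> I \<Longrightarrow> B b \<subseteq> Q b' \<or> B b \<inter> Q b' = {}"
  shows "ennreal (((\<Sum>b\<in>I. card (B b) / card (Q b) * ln (card (B b))) - 1) / (2 * ln 2))
    \<le> (\<integral>\<^sup>+ A. of_nat (length (enc A)) \<partial>N)"
\<comment> \<open>If the length is not integrable, its expectation is infinite and the bound is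
  trivial.\<close>
proof (cases "integrable N (\<lambda>A. real (length (enc A)))")
  case False
  have "(\<lambda>A. real (length (enc A))) \<in> borel_measurable N"
    by (rule measurable_compose[OF enc]) simp
  then have "(\<integral>\<^sup>+ A. ennreal (real (length (enc A))) \<partial>N) = \<infinity>"
    using False by (simp add: integrable_iff_bounded less_top[symmetric])
  then show ?thesis by (simp add: ennreal_of_nat_eq_real_of_nat)
next
  case integrable: True
  have fin_Q: "finite (Q b)" if "b \<in> I" for b using Q[OF that] finite_P finite_subset by blast
  have fin_B: "finite (B b)" if "b \<in> I" for b using B(1)[OF that] fin_Q[OF that] finite_subset by blast
  have card_B: "card (B b) > 0" if "b \<in> I" for b using B(2) fin_B that by (simp add: card_gt_0_iff)
  have Q_ne: "Q b \<noteq> {}" if "b \<in> I" for b using B that by blast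
  \<comment> \<open>\<open>T\<close> collects the true answers to the queries \<open>Q b\<close>,
    and \<open>D\<close> the answers decoded from a word; the two agree on code words.\<close>
  define T where "T A = restrict (\<lambda>b. RMQ A (Q b)) I" for A
  define D where "D w = restrict (\<lambda>b. dec w (Q b)) I" for w
  have D: "D (enc A) = T A" if "A \<in> space N" for A
    using dec[OF that] by (auto simp: D_def T_def)
  define \<T> where "\<T> = T ` space N"
  have "T A \<in> I \<rightarrow>\<^sub>E P" for A
    using RMQ_is_max(1)[OF fin_Q Q_ne] Q by (auto simp: T_def)
  then have fin_T: "finite \<T>"
    using finite_PiE[OF I, of "\<lambda>_. P"] finite_P finite_subset[of \<T>] by (auto simp: \<T>_def)
  have T_pattern: "T A = T A'" if "pattern P A = pattern P A'" for A A'
    unfolding T_def using RMQ_cong[OF that Q] by auto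
  have T_sets: "{A \<in> space N. T A = t} \<in> sets N" for t
    by (rule pattern_event) (use T_pattern in metis)
  \<comment> \<open>Only blocks that contain their answer count. By the uniformity of the maximum on
    such blocks, the answer vector \<open>t\<close> has probability at most \<open>1 / h t\<close>,
    so \<open>ln (h t)\<close> is a lower bound for its information content.\<close>
  define h where "h t = (\<Prod>b\<in>{b\<in>I. t b \<in> B b}. real (card (B b)))" for t
  have h_pos: "h t > 0" for t unfolding h_def using card_B by (intro prod_pos) auto
  have prob_T: "N.prob {A \<in> space N. T A = t} * h t \<le> 1" for t
  proof -
    let ?J = "{b\<in>I. t b \<in> B b}"
    have J: "?J \<subseteq> I" "finite ?J" using I by auto
    let ?G = "{A \<in> space N. \<forall>b\<in>?J. strict_max A (Q b) (t b)}"
    have "N.prob {A \<in> space N. T A = t} \<le> N.prob ?G"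
    proof (rule N.finite_measure_mono_AE)
      show "AE A in N. A \<in> {A \<in> space N. T A = t} \<longrightarrow> A \<in> ?G"
        using AE_inj_on
      proof eventually_elim
        case (elim A)
        have "strict_max A (Q b) (T A b)" if "b \<in> I" for b
          using strict_max_RMQ[OF elim Q fin_Q Q_ne] that by (simp add: T_def)
        then show ?case by auto
      qed
      have "strict_max A (Q b) (t b) \<longleftrightarrow> strict_max A' (Q b) (t b)"
        if "pattern P A = pattern P A'" "b \<in> I" for A A' b
        using strict_max_pattern[OF that(1) Q[OF that(2)]] .
      then show "?G \<in> sets N" by (intro pattern_event) blast
    qed
    then have "N.prob {A \<in> space N. T A = t} * h t \<le> N.prob ?G * h t"
      using h_pos[of t] by (simp add: mult_right_mono)
    also have "\<dots> \<le> 1"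
      unfolding h_def using J B(1) Q disj by (intro prob_strict_max_le) auto
    finally show ?thesis .
  qed
  \<comment> \<open>A shortest word that decodes to \<open>t\<close>. It is no longer than any
    actual code word for \<open>t\<close>, and distinct answer vectors get distinct words because
    \<open>D\<close> recovers \<open>t\<close>.\<close>
  have "\<exists>w. D w = t \<and> (\<forall>w'. D w' = t \<longrightarrow> length w \<le> length w')" if "t \<in> \<T>" for t
    using ex_has_least_nat[of "\<lambda>w. D w = t" _ length] D that unfolding \<T>_def by blast
  then obtain w where w: "\<And>t. t \<in> \<T> \<Longrightarrow> D (w t) = t"
      "\<And>t w'. t \<in> \<T> \<Longrightarrow> D w' = t \<Longrightarrow> length (w t) \<le> length w'"
    by metis
  have "inj_on w \<T>" by (metis inj_onI w(1))
  then have "(\<Sum>t\<in>\<T>. (1/4 :: real) ^ length (w t)) = (\<Sum>v\<in>w ` \<T>. (1/4) ^ length v)"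
    by (simp add: sum.reindex)
  also have "\<dots> \<le> 2" using fin_T by (intro sum_words_le) simp
  finally have sum_w: "(\<Sum>t\<in>\<T>. (1/4 :: real) ^ length (w t)) \<le> 2" .
  \<comment> \<open>\<open>X\<close> has expectation 1 plus the block entropy, and \<open>Y\<close>
    has expectation at most 2. They are compared pointwise through \<open>1 + ln z \<le> z\<close>
    with \<open>z = h t * (1/4) ^ length (w t)\<close>, whose logarithm splits off
    \<open>2 * ln 2 * length (w t)\<close>.\<close>
  define X where "X A = 1 + (\<Sum>b\<in>I. indicat_real {A \<in> space N. RMQ A (Q b) \<in> B b} A * ln (card (B b)))" for A
  define Y where "Y A = (\<Sum>t\<in>\<T>. indicat_real {A \<in> space N. T A = t} A * (h t * (1/4) ^ length (w t)))" for A
  have X_le: "X A \<le> 2 * ln 2 * length (enc A) + Y A" if A: "A \<in> space N" for A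
  proof -
    have t: "T A \<in> \<T>" using A by (simp add: \<T>_def)
    have "(\<Sum>b\<in>I. indicat_real {A \<in> space N. RMQ A (Q b) \<in> B b} A * ln (card (B b)))
        = (\<Sum>b\<in>I. if T A b \<in> B b then ln (card (B b)) else 0)"
      using A by (intro sum.cong) (auto simp: T_def)
    also have "\<dots> = (\<Sum>b\<in>{b\<in>I. T A b \<in> B b}. ln (card (B b)))"
      using I by (simp add: sum.inter_filter)
    also have "\<dots> = ln (h (T A))"
      unfolding h_def using I card_B by (subst ln_prod) auto
    finally have "X A = 1 + ln (h (T A))" by (simp add: X_def)
    also have "\<dots> = 1 + ln (h (T A) * (1/4) ^ length (w (T A))) + 2 * ln 2 * length (w (T A))"
    proof -
      have "ln (4 :: real) = 2 * ln 2" using ln_realpow[of 2 2] by simp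
      then show ?thesis using h_pos[of "T A"] by (simp add: ln_mult ln_realpow ln_div)
    qed
    also have "\<dots> \<le> h (T A) * (1/4) ^ length (w (T A)) + 2 * ln 2 * length (enc A)"
    proof (intro add_mono mult_left_mono)
      show "1 + ln (h (T A) * (1/4) ^ length (w (T A))) \<le> h (T A) * (1/4) ^ length (w (T A))"
        using ln_le_minus_one[of "h (T A) * (1/4) ^ length (w (T A))"] h_pos[of "T A"] by simp
      show "real (length (w (T A))) \<le> real (length (enc A))"
        using w(2)[OF t D[OF A]] by simp
    qed auto
    also have "h (T A) * (1/4) ^ length (w (T A)) = Y A"
    proof -
      have "Y A = (\<Sum>t\<in>\<T>. if t = T A then h t * (1/4) ^ length (w t) else 0)"
        unfolding Y_def using A by (intro sum.cong) auto
      then show ?thesis using fin_T t by simp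
    qed
    finally show ?thesis by simp
  qed
  have E_sets: "{A \<in> space N. RMQ A (Q b) \<in> B b} \<in> sets N" if "b \<in> I" for b
    by (rule pattern_event) (use RMQ_cong[OF _ Q[OF that]] in metis)
  have prob_E: "N.prob {A \<in> space N. RMQ A (Q b) \<in> B b} = card (B b) / card (Q b)" if b: "b \<in> I" for b
  proof -
    have "{A \<in> space N. RMQ A (Q b) \<in> B b} = (\<Union>p\<in>B b. {A \<in> space N. RMQ A (Q b) = p})" by auto
    also have "N.prob \<dots> = (\<Sum>p\<in>B b. N.prob {A \<in> space N. RMQ A (Q b) = p})"
    proof (rule N.finite_measure_finite_Union[OF fin_B[OF b]])
      have "{A \<in> space N. RMQ A (Q b) = p} \<in> sets N" for p
        by (rule pattern_event) (use RMQ_cong[OF _ Q[OF b]] in metis)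
      then show "(\<lambda>p. {A \<in> space N. RMQ A (Q b) = p}) ` B b \<subseteq> sets N" by blast
    qed (auto simp: disjoint_family_on_def)
    also have "\<dots> = (\<Sum>p\<in>B b. 1 / card (Q b))"
      using prob_RMQ[OF Q[OF b]] B(1)[OF b] by (intro sum.cong) auto
    finally show ?thesis by simp
  qed
  have int_E: "integrable N (indicat_real {A \<in> space N. RMQ A (Q b) \<in> B b})" if "b \<in> I" for b
    using E_sets[OF that] by (intro integrable_real_indicator) (auto simp: N.emeasure_eq_measure)
  have int_T: "integrable N (indicat_real {A \<in> space N. T A = t})" for t
    using T_sets by (intro integrable_real_indicator) (auto simp: N.emeasure_eq_measure)
  have int_sumX: "integrable N (\<lambda>A. \<Sum>b\<in>I. indicat_real {A \<in> space N. RMQ A (Q b) \<in> B b} A * ln (card (B b)))"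
    using int_E by (intro Bochner_Integration.integrable_sum integrable_mult_left) auto
  have int_X: "integrable N X"
    unfolding X_def using int_sumX by (intro Bochner_Integration.integrable_add) auto
  have int_Y: "integrable N Y"
    unfolding Y_def using int_T by (intro Bochner_Integration.integrable_sum integrable_mult_left) auto
  have "1 + (\<Sum>b\<in>I. card (B b) / card (Q b) * ln (card (B b))) = (\<integral>A. X A \<partial>N)"
  proof -
    have "(\<integral>A. X A \<partial>N) = 1 + (\<integral>A. (\<Sum>b\<in>I. indicat_real {A \<in> space N. RMQ A (Q b) \<in> B b} A * ln (card (B b))) \<partial>N)"
      unfolding X_def using int_sumX by (subst Bochner_Integration.integral_add) (auto simp: N.prob_space)
    also have "\<dots> = 1 + (\<Sum>b\<in>I. N.prob {A \<in> space N. RMQ A (Q b) \<in> B b} * ln (card (B b)))"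
      using int_E by (subst Bochner_Integration.integral_sum) (auto simp: Int_absorb2 intro!: sum.cong)
    also have "\<dots> = 1 + (\<Sum>b\<in>I. card (B b) / card (Q b) * ln (card (B b)))"
      using prob_E by simp
    finally show ?thesis by simp
  qed
  also have "\<dots> \<le> (\<integral>A. 2 * ln 2 * real (length (enc A)) + Y A \<partial>N)"
    using int_X int_Y integrable X_le by (intro integral_mono) auto
  also have "\<dots> = 2 * ln 2 * (\<integral>A. real (length (enc A)) \<partial>N) + (\<integral>A. Y A \<partial>N)"
    using int_Y integrable by simp
  also have "(\<integral>A. Y A \<partial>N) = (\<Sum>t\<in>\<T>. N.prob {A \<in> space N. T A = t} * (h t * (1/4) ^ length (w t)))"
    unfolding Y_def using int_T
    by (subst Bochner_Integration.integral_sum) (auto simp: Int_absorb2 intro!: sum.cong)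
  also have "\<dots> \<le> (\<Sum>t\<in>\<T>. (1/4) ^ length (w t))"
  proof (rule sum_mono)
    fix t
    have "(N.prob {A \<in> space N. T A = t} * h t) * (1/4) ^ length (w t) \<le> 1 * (1/4) ^ length (w t)"
      using prob_T by (intro mult_right_mono) auto
    then show "N.prob {A \<in> space N. T A = t} * (h t * (1/4) ^ length (w t)) \<le> (1/4) ^ length (w t)"
      by (simp add: mult.assoc)
  qed
  \<comment> \<open>The 1 on the left against the 2 on the right leaves the loss of 1 in the
    claim.\<close>
  also have "\<dots> \<le> 2" by (rule sum_w)
  finally have "((\<Sum>b\<in>I. card (B b) / card (Q b) * ln (card (B b))) - 1) / (2 * ln 2)
      \<le> (\<integral>A. real (length (enc A)) \<partial>N)"
    by (simp add: field_simps)
  moreover have "(\<integral>\<^sup>+ A. of_nat (length (enc A)) \<partial>N) = ennreal (\<integral>A. real (length (enc A)) \<partial>N)"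
    unfolding ennreal_of_nat_eq_real_of_nat using integrable by (intro nn_integral_eq_integral) auto
  ultimately show ?thesis by (simp add: ennreal_leI)
qed

text \<open>The empty string decodes to a single answer, which is correct with probability at most 1/2.\<close>

lemma expected_length_ge_half:
  fixes enc :: "array \<Rightarrow> bool list"
  assumes enc: "enc \<in> N \<rightarrow>\<^sub>M count_space UNIV"
    and dec: "\<And>A. A \<in> space N \<Longrightarrow> dec (enc A) q = RMQ A q"
    and q: "q \<subseteq> P" "2 \<le> card q"
  shows "ennreal (1/2) \<le> (\<integral>\<^sup>+ A. of_nat (length (enc A)) \<partial>N)"
proof -
  have fin_q: "finite q" "q \<noteq> {}" using q card.infinite by force+
  let ?E = "{A \<in> space N. enc A \<noteq> []}"
  have E: "?E \<in> sets N"
    using measurable_sets[OF enc, of "- {[]}"] by (simp add: vimage_def Int_def conj_commute)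
  have "N.prob (space N - ?E) \<le> N.prob {A \<in> space N. RMQ A q = dec [] q}"
  proof (rule N.finite_measure_mono)
    show "{A \<in> space N. RMQ A q = dec [] q} \<in> sets N"
      by (rule pattern_event) (use RMQ_cong[OF _ q(1)] in metis)
    show "space N - ?E \<subseteq> {A \<in> space N. RMQ A q = dec [] q}"
      using dec by force
  qed
  also have "\<dots> \<le> 1 / 2"
  proof (cases "dec [] q \<in> q")
    case True
    then show ?thesis using prob_RMQ[OF q(1) True] q(2) by (simp add: frac_le)
  next
    case False
    then have "RMQ A q \<noteq> dec [] q" for A using RMQ_is_max(1)[OF fin_q, of A] by metis
    then have "{A \<in> space N. RMQ A q = dec [] q} = {}" by blast
    then show ?thesis by (simp only: measure_empty)
  qed
  finally have "1 / 2 \<le> N.prob ?E" using N.prob_compl[OF E] by simp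
  then have "ennreal (1/2) \<le> emeasure N ?E" unfolding N.emeasure_eq_measure by (rule ennreal_leI)
  also have "\<dots> = (\<integral>\<^sup>+ A. indicator ?E A \<partial>N)" using E by simp
  also have "\<dots> \<le> (\<integral>\<^sup>+ A. of_nat (length (enc A)) \<partial>N)"
  proof (rule nn_integral_mono)
    fix A
    have "of_nat 1 \<le> (of_nat (length (enc A)) :: ennreal)" if "enc A \<noteq> []"
      using that by (subst of_nat_le_iff) (cases "enc A", auto)
    then show "indicator ?E A \<le> (of_nat (length (enc A)) :: ennreal)"
      by (auto simp: indicator_def)
  qed
  finally show ?thesis .
qed

end

section \<open>Dyadic blocks\<close>

definition dyadic_query :: "nat \<times> nat \<Rightarrow> position set" where
  "dyadic_query b = {1..2 ^ (fst b + 1)} \<times> {1..2 ^ (snd b + 1)}"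

definition dyadic_block :: "nat \<times> nat \<Rightarrow> position set" where
  "dyadic_block b = {2 ^ fst b <.. 2 ^ (fst b + 1)} \<times> {2 ^ snd b <.. 2 ^ (snd b + 1)}"

lemma card_dyadic_block: "card (dyadic_block b) = 2 ^ (fst b + snd b)"
  by (simp add: dyadic_block_def power_add)

lemma card_dyadic_query: "card (dyadic_query b) = 4 * 2 ^ (fst b + snd b)"
  by (simp add: dyadic_query_def power_add)

lemma dyadic_block_subset: "dyadic_block b \<subseteq> dyadic_query b"
  by (auto simp: dyadic_block_def dyadic_query_def)

text \<open>The open left end matters: for \<open>j < i\<close> the query side ends at
  \<open>2 ^ (j + 1) \<le> 2 ^ i\<close>, and \<open>2 ^ i\<close> itself is not in the block
  side.\<close>

lemma dyadic_interval_cases: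
  fixes i j :: nat
  shows "i \<le> j \<and> {2 ^ i <.. 2 ^ (i + 1)} \<subseteq> {1..2 ^ (j + 1) :: nat} \<or>
    j < i \<and> {2 ^ i <.. 2 ^ (i + 1)} \<inter> {1..2 ^ (j + 1) :: nat} = {}"
proof (cases "i \<le> j")
  case True
  then have "(2 :: nat) ^ (i + 1) \<le> 2 ^ (j + 1)" by (intro power_increasing) auto
  moreover have "{a <.. b} \<subseteq> {1..c}" if "b \<le> c" for a b c :: nat using that by auto
  ultimately have "{2 ^ i <.. 2 ^ (i + 1)} \<subseteq> {1..2 ^ (j + 1) :: nat}" by blast
  then show ?thesis using True by blast
next
  case False
  then have "(2 :: nat) ^ (j + 1) \<le> 2 ^ i" by (intro power_increasing) auto
  then have "{2 ^ i <.. 2 ^ (i + 1)} \<inter> {1..2 ^ (j + 1) :: nat} = {}" by auto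
  then show ?thesis using False by (metis not_le)
qed

text \<open>Containment in both coordinates gives containment, and disjointness in one of them gives
  disjointness. This is the condition under which swapping cells of one block leaves the other
  queries invariant.\<close>

lemma dyadic_block_cases: "dyadic_block b \<subseteq> dyadic_query c \<or> dyadic_block b \<inter> dyadic_query c = {}"
  using dyadic_interval_cases[of "fst b" "fst c"] dyadic_interval_cases[of "snd b" "snd c"]
  unfolding dyadic_block_def dyadic_query_def by blast

lemma dyadic_block_disjoint:
  assumes "b \<noteq> c"
  shows "dyadic_block b \<inter> dyadic_block c = {}"
proof -
  have *: "{2 ^ i <.. 2 ^ (i + 1)} \<inter> {2 ^ j <.. 2 ^ (j + 1) :: nat} = {}" if "i \<noteq> j" for i j :: nat
    using that
  proof (induction i j rule: linorder_wlog)
    case (le i j)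
    then have "(2 :: nat) ^ (i + 1) \<le> 2 ^ j" by (intro power_increasing) auto
    then show ?case by force
  qed (simp add: Int_commute)
  have "fst b \<noteq> fst c \<or> snd b \<noteq> snd c" using assms by (simp add: prod_eq_iff)
  then show ?thesis using *[of "fst b" "fst c"] *[of "snd b" "snd c"]
    unfolding dyadic_block_def by blast
qed

section \<open>Lower bound from the dyadic scales\<close>

lemma ud_encodings_obtain_dec:
  assumes "enc \<in> ud_encodings m n Q"
  obtains dec where "enc \<in> random_array m n \<rightarrow>\<^sub>M count_space UNIV"
    "\<And>A q. A \<in> space (random_array m n) \<Longrightarrow> q \<in> Q \<Longrightarrow> dec (enc A) q = RMQ A q"
  using assms unfolding ud_encodings_def is_encoding_def space_random_array by blast

lemma two_sided_queriesI:
  "1 \<le> i \<Longrightarrow> i \<le> m \<Longrightarrow> 1 \<le> j \<Longrightarrow> j \<le> n \<Longrightarrow> {1..i} \<times> {1..j} \<in> two_sided_queries m n"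
  by (auto simp: two_sided_queries_def)

text \<open>Of the \<open>k + l\<close> bits of a block only the \<open>l\<close> column bits are
  kept, which is enough for the order of magnitude when there are at least as many columns as rows.
  A block is a quarter of its query, hence the weight 1/4 for each scale.\<close>

lemma expected_length_ge_dyadic:
  assumes "enc \<in> ud_encodings m n (two_sided_queries m n)" "2 ^ K \<le> m" "2 ^ L \<le> n"
  shows "ennreal (real K * real L * (real L - 1) / 16 - 1) \<le> expected_length m n enc"
proof -
  let ?I = "{..<K} \<times> {..<L}"
  interpret iid_array "uniform_measure lborel {0..<1}" "positions m n" by (rule iid_array_uniform)
  have N: "random_array m n = N" by (simp add: random_array_def)
  obtain dec where enc: "enc \<in> N \<rightarrow>\<^sub>M count_space UNIV"
    and dec: "\<And>A q. A \<in> space N \<Longrightarrow> q \<in> two_sided_queries m n \<Longrightarrow> dec (enc A) q = RMQ A q"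
    using ud_encodings_obtain_dec[OF assms(1)] unfolding N by blast
  have le: "2 ^ (fst b + 1) \<le> m" "2 ^ (snd b + 1) \<le> n" if "b \<in> ?I" for b
  proof -
    have "(2 :: nat) ^ (fst b + 1) \<le> 2 ^ K" "(2 :: nat) ^ (snd b + 1) \<le> 2 ^ L"
      using that by (intro power_increasing; auto)+
    then show "2 ^ (fst b + 1) \<le> m" "2 ^ (snd b + 1) \<le> n" using assms(2,3) by linarith+
  qed
  have query: "dyadic_query b \<in> two_sided_queries m n" if "b \<in> ?I" for b
    unfolding dyadic_query_def using le[OF that] by (intro two_sided_queriesI) auto
  have sub: "dyadic_query b \<subseteq> positions m n" if "b \<in> ?I" for b
    unfolding dyadic_query_def positions_def using le[OF that] by (intro Sigma_mono) auto
  have ne: "dyadic_block b \<noteq> {}" for b using card_dyadic_block[of b] by (metis card.empty power_not_zero zero_neq_numeral)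
  have "ennreal (((\<Sum>b\<in>?I. card (dyadic_block b) / card (dyadic_query b) * ln (card (dyadic_block b))) - 1) / (2 * ln 2))
      \<le> expected_length m n enc"
    unfolding expected_length_def N
    by (rule expected_length_ge_block_entropy[where dec = dec])
      (use enc dec query sub ne dyadic_block_subset dyadic_block_disjoint dyadic_block_cases in auto)
  moreover have "real K * real L * (real L - 1) / 16 - 1 \<le>
      ((\<Sum>b\<in>?I. card (dyadic_block b) / card (dyadic_query b) * ln (card (dyadic_block b))) - 1) / (2 * ln 2)"
  proof -
    \<comment> \<open>Makes the loss of 1 at most \<open>2 * ln 2\<close>, so that after division by
      \<open>2 * ln 2\<close> at most 1 is lost.\<close>
    have ln2: "1 / 2 \<le> ln (2 :: real)" using ln2_ge_two_thirds by simp
    have gauss: "(\<Sum>l<L. real l) = real L * (real L - 1) / 2"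
      by (induction L) (auto simp: field_simps)
    have "ln 2 * (real K * real L * (real L - 1) / 8) = (\<Sum>b\<in>?I. 1/4 * (real (snd b) * ln 2))"
    proof -
      have "(\<Sum>b\<in>?I. 1/4 * (real (snd b) * ln 2)) = (\<Sum>k<K. \<Sum>l<L. 1/4 * (real l * ln 2))"
        unfolding sum.cartesian_product by (rule sum.cong) auto
      also have "\<dots> = real K * (1/4 * ((\<Sum>l<L. real l) * ln 2))"
        by (simp only: sum_constant card_lessThan sum_distrib_left[symmetric] sum_distrib_right[symmetric])
      finally show ?thesis unfolding gauss by simp
    qed
    also have "\<dots> \<le> (\<Sum>b\<in>?I. card (dyadic_block b) / card (dyadic_query b) * ln (card (dyadic_block b)))"
    proof (rule sum_mono)
      fix b
      show "1/4 * (real (snd b) * ln 2) \<le> card (dyadic_block b) / card (dyadic_query b) * ln (card (dyadic_block b))"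
        by (simp add: card_dyadic_block card_dyadic_query ln_realpow mult_right_mono)
    qed
    finally have "ln 2 * (real K * real L * (real L - 1) / 8) - 2 * ln 2 \<le>
        (\<Sum>b\<in>?I. card (dyadic_block b) / card (dyadic_query b) * ln (card (dyadic_block b))) - 1"
      using ln2 by linarith
    moreover have "ln 2 * (real K * real L * (real L - 1) / 8) - 2 * ln 2 =
        (real K * real L * (real L - 1) / 16 - 1) * (2 * ln 2)"
      by (simp add: field_simps)
    ultimately show ?thesis by (simp add: pos_le_divide_eq)
  qed
  ultimately show ?thesis using ennreal_leI order_trans by blast
qed

text \<open>Covers small dimensions, where the dyadic bound can be negative. The query of the first
  two cells of the first row already has two equally likely answers.\<close>

lemma two_sided_expected_length_ge_half:
  assumes "enc \<in> ud_encodings m n (two_sided_queries m n)" "1 \<le> m" "2 \<le> n"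
  shows "ennreal (1/2) \<le> expected_length m n enc"
proof -
  interpret iid_array "uniform_measure lborel {0..<1}" "positions m n" by (rule iid_array_uniform)
  have N: "random_array m n = N" by (simp add: random_array_def)
  obtain dec where enc: "enc \<in> N \<rightarrow>\<^sub>M count_space UNIV"
    and dec: "\<And>A q. A \<in> space N \<Longrightarrow> q \<in> two_sided_queries m n \<Longrightarrow> dec (enc A) q = RMQ A q"
    using ud_encodings_obtain_dec[OF assms(1)] unfolding N by blast
  have "{1..1} \<times> {1..2} \<in> two_sided_queries m n"
    using assms by (intro two_sided_queriesI) auto
  moreover have "{1..1} \<times> {1..2} \<subseteq> positions m n"
    unfolding positions_def using assms by (intro Sigma_mono) auto
  ultimately show ?thesis
    unfolding expected_length_def N
    by (intro expected_length_ge_half[where dec = dec and q = "{1..1} \<times> {1..2}"] enc dec) auto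
qed

lemma expected_effective_entropy_lower:
  assumes "2 \<le> m" "m \<le> n"
  shows "ennreal (1 / 512 * ((log 2 n)\<^sup>2 * log 2 m)) \<le> expected_effective_entropy m n (two_sided_queries m n)"
  unfolding expected_effective_entropy_def
proof (rule INF_greatest)
  fix enc assume enc: "enc \<in> ud_encodings m n (two_sided_queries m n)"
  define x y where "x = log 2 m" and "y = log 2 n"
  have x: "1 \<le> x" and y: "x \<le> y" using assms by (auto simp: x_def y_def)
  show "ennreal (1 / 512 * ((log 2 n)\<^sup>2 * log 2 m)) \<le> expected_length m n enc"
  \<comment> \<open>Up to the threshold 256 the claimed bound is at most
    \<open>256 / 512 = 1/2\<close>; above it the dyadic bound absorbs its additive loss.\<close>
  proof (cases "y\<^sup>2 * x \<le> 256")
    case True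
    then have "ennreal (1 / 512 * (y\<^sup>2 * x)) \<le> ennreal (1/2)" by (intro ennreal_leI) linarith
    also have "\<dots> \<le> expected_length m n enc" using enc assms by (intro two_sided_expected_length_ge_half) auto
    finally show ?thesis by (simp add: x_def y_def)
  next
    case False
    \<comment> \<open>Needed for \<open>y / 2 \<le> real L - 1\<close>: rounding down and
      subtracting 1 cost at most 2, which is at most \<open>y / 2\<close> from 4 on.\<close>
    have y4: "4 \<le> y"
    proof (rule ccontr)
      assume "\<not> 4 \<le> y"
      then have "y\<^sup>2 * x \<le> 4\<^sup>2 * 4" using x y by (intro mult_mono power_mono) auto
      then show False using False by simp
    qed
    define K L where "K = nat \<lfloor>x\<rfloor>" and "L = nat \<lfloor>y\<rfloor>"
    have K: "K \<le> x" "x / 2 \<le> K" and L: "L \<le> y" "y / 2 \<le> L" "y / 2 \<le> real L - 1"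
    proof -
      have "real K = of_int \<lfloor>x\<rfloor>" "real L = of_int \<lfloor>y\<rfloor>" "1 \<le> \<lfloor>x\<rfloor>" using x y4 by (auto simp: K_def L_def)
      moreover have "of_int \<lfloor>x\<rfloor> \<le> x" "x < of_int \<lfloor>x\<rfloor> + 1" "of_int \<lfloor>y\<rfloor> \<le> y" "y < of_int \<lfloor>y\<rfloor> + 1"
        by linarith+
      moreover have "(1 :: real) \<le> of_int \<lfloor>x\<rfloor>" using calculation(3) by simp
      ultimately show "K \<le> x" "x / 2 \<le> K" "L \<le> y" "y / 2 \<le> L" "y / 2 \<le> real L - 1"
        using y4 by linarith+
    qed
    have "2 powr K \<le> 2 powr x" "2 powr L \<le> 2 powr y" using K L by simp_all
    then have "real (2 ^ K) \<le> m" "real (2 ^ L) \<le> n"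
      using assms by (simp_all add: x_def y_def powr_realpow)
    then have "2 ^ K \<le> m" "2 ^ L \<le> n" by (simp_all only: of_nat_le_iff)
    then have "ennreal (real K * real L * (real L - 1) / 16 - 1) \<le> expected_length m n enc"
      using enc by (intro expected_length_ge_dyadic) auto
    moreover have "1 / 512 * (y\<^sup>2 * x) \<le> real K * real L * (real L - 1) / 16 - 1"
    proof -
      have "x / 2 * (y / 2) * (y / 2) \<le> real K * real L * (real L - 1)"
        using K L x y by (intro mult_mono) auto
      then have "y\<^sup>2 * x \<le> 8 * (real K * real L * (real L - 1))"
        by (simp add: power2_eq_square mult_ac)
      then show ?thesis using False by simp
    qed
    ultimately show ?thesis
      unfolding x_def[symmetric] y_def[symmetric] using ennreal_leI order_trans by blast
  qed
qed

theorem theorem4: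
  "\<exists>c1 c2 :: real. 0 < c1 \<and> 0 < c2 \<and>
     (\<forall>m n :: nat. 2 \<le> m \<longrightarrow> m \<le> n \<longrightarrow>
        ennreal (c1 * ((log 2 (real n))\<^sup>2 * log 2 (real m)))
          \<le> expected_effective_entropy m n (two_sided_queries m n) \<and>
        expected_effective_entropy m n (two_sided_queries m n)
          \<le> ennreal (c2 * ((log 2 (real n))\<^sup>2 * log 2 (real m))))"
  using expected_effective_entropy_lower expected_effective_entropy_upper
  by (intro exI[of _ "1 / 512"] exI[of _ 18]) simp

end
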